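(* Let $\mathcal{A}$ and $\mathcal{U}$ be Banach algebras such that $\mathcal{U}$ is a Banach $\mathcal{A}$-bimodule with compatible actions and norm. Assume that every derivation $D$ on $\mathcal{A}\ltimes\mathcal{U}$ satisfies $D(\{0\}\times\mathcal{U})\subseteq\{0\}\times\mathcal{U}$. Suppose that $\delta(\mathcal{A})\subseteq ann_{\mathcal{A}}\mathcal{U}$ for every $\delta\in Z^1(\mathcal{A})$. If $H^1(\mathcal{A},\mathcal{U})=(0)$, then there is a linear isomorphism $$H^1(\mathcal{A}\ltimes\mathcal{U})\cong\frac{Z^1(\mathcal{A})\times[Hom_{\mathcal{A}}(\mathcal{U})\cap Z^1(\mathcal{U})]}{\mathcal{E}},$$ where $\mathcal{E}$ is the following linear subspace of $Z^1(\mathcal{A})\times[Hom_{\mathcal{A}}(\mathcal{U})\cap Z^1(\mathcal{U})]$: $$\mathcal{E}=\{(id_a,\ r_a+id_{\mathcal{U},x})\mid a\in\mathcal{A},\ x\in\mathcal{U},\ id_{\mathcal{A},x}=0\}.$$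
   Context: All algebras are over $\mathbb{C}$. "Banach $\mathcal{A}$-bimodule with compatible actions and norm" means: $\|ax\|\le\|a\|\|x\|$, $\|xa\|\le\|x\|\|a\|$, and $a(xy)=(ax)y$, $(xy)a=x(ya)$, $(xa)y=x(ay)$ for all $a\in\mathcal{A}$, $x,y\in\mathcal{U}$. The semidirect product $\mathcal{A}\ltimes\mathcal{U}$ is $\mathcal{A}\times\mathcal{U}$ with multiplication $(a,x)(b,y)=(ab,\,ay+xb+xy)$ and norm $\|(a,x)\|=\|a\|+\|x\|$. For a Banach algebra $\mathcal{B}$ and a Banach $\mathcal{B}$-bimodule $\mathcal{X}$, a derivation $\delta:\mathcal{B}\to\mathcal{X}$ is a linear map with $\delta(bc)=b\delta(c)+\delta(b)c$; inner derivations are the maps $b\mapsto bx-xb$ with $x\in\mathcal{X}$; $Z^1(\mathcal{B},\mathcal{X})$ is the space of continuous derivations, $N^1(\mathcal{B},\mathcal{X})$ the space of inner derivations, $H^1(\mathcal{B},\mathcal{X})=Z^1(\mathcal{B},\mathcal{X})/N^1(\mathcal{B},\mathcal{X})$; write $Z^1(\mathcal{B}),N^1(\mathcal{B}),H^1(\mathcal{B})$ when $\mathcal{X}=\mathcal{B}$. $Hom_{\mathcal{A}}(\mathcal{U})$ is the space of continuous $\mathcal{A}$-bimodule homomorphisms $\mathcal{U}\to\mathcal{U}$. $ann_{\mathcal{A}}\mathcal{U}=\{a\in\mathcal{A}\mid a\mathcal{U}=\mathcal{U}a=(0)\}$. Notation: $id_a(b)=ba-ab$ ($b\in\mathcal{A}$);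 $id_{\mathcal{A},x}:\mathcal{A}\to\mathcal{U}$, $id_{\mathcal{A},x}(b)=bx-xb$; $id_{\mathcal{U},x}:\mathcal{U}\to\mathcal{U}$, $id_{\mathcal{U},x}(y)=yx-xy$; $r_a:\mathcal{U}\to\mathcal{U}$, $r_a(y)=ya-ay$. The symbol $\cong$ denotes isomorphism of linear spaces. *)

theory Defs
  imports
    "HOL-Analysis.Analysis"
    "HOL-Library.Function_Algebras"
    "HOL-Library.Set_Algebras"
begin

section \<open>Complex vector spaces, Banach spaces and Banach algebras\<close>

class complex_vector = ab_group_add +
  fixes scaleC :: "complex \<Rightarrow> 'a \<Rightarrow> 'a" (infixr \<open>*\<^sub>C\<close> 75)
  assumes scaleC_add_right: "c *\<^sub>C (x + y) = c *\<^sub>C x + c *\<^sub>C y"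
    and scaleC_add_left: "(c + d) *\<^sub>C x = c *\<^sub>C x + d *\<^sub>C x"
    and scaleC_scaleC: "c *\<^sub>C d *\<^sub>C x = (c * d) *\<^sub>C x"
    and scaleC_one: "1 *\<^sub>C x = x"

interpretation complex_vector: vector_space "scaleC :: complex \<Rightarrow> 'a \<Rightarrow> 'a::complex_vector"
  by standard (simp_all add: scaleC_add_right scaleC_add_left scaleC_scaleC scaleC_one)

instantiation "fun" :: (type, complex_vector) complex_vector
begin

definition scaleC_fun :: "complex \<Rightarrow> ('a \<Rightarrow> 'b) \<Rightarrow> 'a \<Rightarrow> 'b"
  where "c *\<^sub>C f = (\<lambda>x. c *\<^sub>C f x)"

instance
  by standard
    (simp_all add: scaleC_fun_def fun_eq_iff scaleC_add_right scaleC_add_left scaleC_scaleC scaleC_one)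

end

instantiation prod :: (complex_vector, complex_vector) complex_vector
begin

definition scaleC_prod :: "complex \<Rightarrow> 'a \<times> 'b \<Rightarrow> 'a \<times> 'b"
  where "c *\<^sub>C p = (c *\<^sub>C fst p, c *\<^sub>C snd p)"

instance
  by standard
    (simp_all add: scaleC_prod_def prod_eq_iff scaleC_add_right scaleC_add_left scaleC_scaleC scaleC_one)

end

class complex_banach = complex_vector + banach +
  assumes scaleR_scaleC: "r *\<^sub>R x = complex_of_real r *\<^sub>C x"
    and norm_scaleC: "norm (c *\<^sub>C x) = cmod c * norm x"

text \<open>Not necessarily unital.\<close>

class complex_banach_algebra = complex_banach + real_normed_algebra +
  assumes mult_scaleC_left: "(c *\<^sub>C x) * y = c *\<^sub>C (x * y)"
    and mult_scaleC_right: "x * (c *\<^sub>C y) = c *\<^sub>C (x * y)"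


section \<open>Bimodules and compatible actions\<close>

locale banach_bimodule =
  fixes lact :: "'a::complex_banach_algebra \<Rightarrow> 'x::complex_banach \<Rightarrow> 'x"
    and ract :: "'x \<Rightarrow> 'a \<Rightarrow> 'x"
  assumes lact_add_left: "lact (a + b) x = lact a x + lact b x"
    and lact_add_right: "lact a (x + y) = lact a x + lact a y"
    and lact_scaleC_left: "lact (c *\<^sub>C a) x = c *\<^sub>C lact a x"
    and lact_scaleC_right: "lact a (c *\<^sub>C x) = c *\<^sub>C lact a x"
    and ract_add_left: "ract (x + y) a = ract x a + ract y a"
    and ract_add_right: "ract x (a + b) = ract x a + ract x b"
    and ract_scaleC_left: "ract (c *\<^sub>C x) a = c *\<^sub>C ract x a"
    and ract_scaleC_right: "ract x (c *\<^sub>C a) = c *\<^sub>C ract x a"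
    and lact_mult: "lact (a * b) x = lact a (lact b x)"
    and ract_mult: "ract x (a * b) = ract (ract x a) b"
    and lact_ract: "ract (lact a x) b = lact a (ract x b)"
    and norm_lact: "norm (lact a x) \<le> norm a * norm x"
    and norm_ract: "norm (ract x a) \<le> norm x * norm a"

locale compatible_banach_bimodule = banach_bimodule lact ract
  for lact :: "'a::complex_banach_algebra \<Rightarrow> 'u::complex_banach_algebra \<Rightarrow> 'u"
    and ract :: "'u \<Rightarrow> 'a \<Rightarrow> 'u" +
  assumes lact_times: "lact a (x * y) = lact a x * y"
    and times_ract: "ract (x * y) a = x * ract y a"
    and ract_times: "ract x a * y = x * lact a y"

definition bimodule_annihilator ::
    "('a \<Rightarrow> 'u::zero \<Rightarrow> 'u) \<Rightarrow> ('u \<Rightarrow> 'a \<Rightarrow> 'u) \<Rightarrow> 'a set"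
  where "bimodule_annihilator lact ract = {a. (\<forall>x. lact a x = 0) \<and> (\<forall>x. ract x a = 0)}"

definition Hom_bimodule ::
    "('a \<Rightarrow> 'u::complex_banach \<Rightarrow> 'u) \<Rightarrow> ('u \<Rightarrow> 'a \<Rightarrow> 'u) \<Rightarrow> ('u \<Rightarrow> 'u) set"
  where "Hom_bimodule lact ract =
    {T. Vector_Spaces.linear scaleC scaleC T \<and> continuous_on UNIV T \<and>
        (\<forall>a x. T (lact a x) = lact a (T x)) \<and> (\<forall>x a. T (ract x a) = ract (T x) a)}"


section \<open>The semidirect product\<close>

text \<open>
  The type is the \<open>\<ell>\<^sup>1\<close>-sum of two Banach spaces; it is distinct from the
  product type, whose library norm is the Euclidean one. The multiplication depends on the
  module actions and therefore is not a class operation but the function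
  \<open>sd_mult\<close> below.
\<close>

datatype ('a, 'u) semidirect = SD (sd_fst: 'a) (sd_snd: 'u)

lemma sd_eq_iff: "p = q \<longleftrightarrow> sd_fst p = sd_fst q \<and> sd_snd p = sd_snd q"
  by (rule semidirect.expand[of p q, THEN iffI[rotated]]) auto

instantiation semidirect :: (ab_group_add, ab_group_add) ab_group_add
begin

definition "0 = SD 0 0"
definition "p + q = SD (sd_fst p + sd_fst q) (sd_snd p + sd_snd q)"
definition "p - q = SD (sd_fst p - sd_fst q) (sd_snd p - sd_snd q)"
definition "- p = SD (- sd_fst p) (- sd_snd p)"

instance
  by standard
    (simp_all add: zero_semidirect_def plus_semidirect_def minus_semidirect_def
      uminus_semidirect_def sd_eq_iff algebra_simps)

end

lemma sd_sel_simps [simp]: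
  "sd_fst 0 = 0" "sd_snd 0 = 0"
  "sd_fst (p + q) = sd_fst p + sd_fst q" "sd_snd (p + q) = sd_snd p + sd_snd q"
  "sd_fst (p - q) = sd_fst p - sd_fst q" "sd_snd (p - q) = sd_snd p - sd_snd q"
  "sd_fst (- p) = - sd_fst p" "sd_snd (- p) = - sd_snd p"
  by (simp_all add: zero_semidirect_def plus_semidirect_def minus_semidirect_def
      uminus_semidirect_def)

instantiation semidirect :: (complex_vector, complex_vector) complex_vector
begin

definition scaleC_semidirect ::
    "complex \<Rightarrow> ('a, 'b) semidirect \<Rightarrow> ('a, 'b) semidirect"
  where "c *\<^sub>C p = SD (c *\<^sub>C sd_fst p) (c *\<^sub>C sd_snd p)"

instance
  by standard
    (simp_all add: scaleC_semidirect_def sd_eq_iff scaleC_add_right scaleC_add_left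
      scaleC_scaleC scaleC_one)

end

instantiation semidirect :: (real_vector, real_vector) real_vector
begin

definition scaleR_semidirect ::
    "real \<Rightarrow> ('a, 'b) semidirect \<Rightarrow> ('a, 'b) semidirect"
  where "r *\<^sub>R p = SD (r *\<^sub>R sd_fst p) (r *\<^sub>R sd_snd p)"

instance
  by standard (simp_all add: scaleR_semidirect_def sd_eq_iff scaleR_add_right scaleR_add_left)

end

instantiation semidirect :: (real_normed_vector, real_normed_vector) real_normed_vector
begin

definition norm_semidirect_def: "norm (p :: ('a, 'b) semidirect) = norm (sd_fst p) + norm (sd_snd p)"
definition sgn_semidirect_def: "sgn (p :: ('a, 'b) semidirect) = p /\<^sub>R norm p"
definition dist_semidirect_def: "dist (p :: ('a, 'b) semidirect) q = norm (p - q)"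

definition uniformity_semidirect_def:
  "(uniformity :: (('a, 'b) semidirect \<times> ('a, 'b) semidirect) filter) =
    (INF e\<in>{0<..}. principal {(x, y). dist x y < e})"
definition open_semidirect_def:
  "open (S :: ('a, 'b) semidirect set) \<longleftrightarrow>
    (\<forall>x\<in>S. \<forall>\<^sub>F (x', y) in uniformity. x' = x \<longrightarrow> y \<in> S)"

instance
proof
  fix p q :: "('a, 'b) semidirect" and r :: real
  show "norm p = 0 \<longleftrightarrow> p = 0"
    by (simp add: norm_semidirect_def sd_eq_iff add_nonneg_eq_0_iff)
  show "norm (p + q) \<le> norm p + norm q"
    using norm_triangle_ineq[of "sd_fst p" "sd_fst q"] norm_triangle_ineq[of "sd_snd p" "sd_snd q"]
    by (simp add: norm_semidirect_def)
  show "norm (r *\<^sub>R p) = \<bar>r\<bar> * norm p"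
    by (simp add: norm_semidirect_def scaleR_semidirect_def distrib_left)
qed (simp_all add: sgn_semidirect_def dist_semidirect_def uniformity_semidirect_def
    open_semidirect_def)

end

instance semidirect :: (banach, banach) banach
proof
  fix X :: "nat \<Rightarrow> ('a, 'b) semidirect"
  assume X: "Cauchy X"
  have "Cauchy (\<lambda>n. sd_fst (X n))"
  proof (rule metric_CauchyI)
    fix e :: real assume "e > 0"
    then obtain M where M: "\<And>m n. m \<ge> M \<Longrightarrow> n \<ge> M \<Longrightarrow> dist (X m) (X n) < e"
      using X metric_CauchyD by blast
    have "dist (sd_fst (X m)) (sd_fst (X n)) < e" if "m \<ge> M" "n \<ge> M" for m n
      using M[OF that] norm_ge_zero[of "sd_snd (X m) - sd_snd (X n)"]
      unfolding dist_norm norm_semidirect_def sd_sel_simps by linarith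
    then show "\<exists>M. \<forall>m\<ge>M. \<forall>n\<ge>M. dist (sd_fst (X m)) (sd_fst (X n)) < e" by blast
  qed
  then obtain a where a: "(\<lambda>n. sd_fst (X n)) \<longlonglongrightarrow> a"
    using Cauchy_convergent convergent_def by blast
  have "Cauchy (\<lambda>n. sd_snd (X n))"
  proof (rule metric_CauchyI)
    fix e :: real assume "e > 0"
    then obtain M where M: "\<And>m n. m \<ge> M \<Longrightarrow> n \<ge> M \<Longrightarrow> dist (X m) (X n) < e"
      using X metric_CauchyD by blast
    have "dist (sd_snd (X m)) (sd_snd (X n)) < e" if "m \<ge> M" "n \<ge> M" for m n
      using M[OF that] norm_ge_zero[of "sd_fst (X m) - sd_fst (X n)"]
      unfolding dist_norm norm_semidirect_def sd_sel_simps by linarith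
    then show "\<exists>M. \<forall>m\<ge>M. \<forall>n\<ge>M. dist (sd_snd (X m)) (sd_snd (X n)) < e" by blast
  qed
  then obtain b where b: "(\<lambda>n. sd_snd (X n)) \<longlonglongrightarrow> b"
    using Cauchy_convergent convergent_def by blast
  have "(\<lambda>n. norm (sd_fst (X n) - a) + norm (sd_snd (X n) - b)) \<longlonglongrightarrow> 0 + 0"
    by (intro tendsto_add tendsto_norm_zero LIM_zero a b)
  then have "(\<lambda>n. dist (X n) (SD a b)) \<longlonglongrightarrow> 0"
    by (simp add: dist_norm norm_semidirect_def)
  then have "X \<longlonglongrightarrow> SD a b"
    using tendsto_dist_iff by blast
  then show "convergent X"
    unfolding convergent_def by blast
qed

instance semidirect :: (complex_banach, complex_banach) complex_banach
  by standard
    (simp_all add: scaleC_semidirect_def scaleR_semidirect_def norm_semidirect_def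
      scaleR_scaleC norm_scaleC distrib_left)

definition sd_mult ::
    "('a::times \<Rightarrow> 'u \<Rightarrow> 'u) \<Rightarrow> ('u \<Rightarrow> 'a \<Rightarrow> 'u) \<Rightarrow>
     ('a, 'u::{plus,times}) semidirect \<Rightarrow> ('a, 'u) semidirect \<Rightarrow> ('a, 'u) semidirect"
  where "sd_mult lact ract p q =
    SD (sd_fst p * sd_fst q)
       (lact (sd_fst p) (sd_snd q) + ract (sd_snd p) (sd_fst q) + sd_snd p * sd_snd q)"

context compatible_banach_bimodule
begin

lemma sd_mult_assoc:
  "sd_mult lact ract (sd_mult lact ract p q) r = sd_mult lact ract p (sd_mult lact ract q r)"
  by (simp add: sd_mult_def mult.assoc lact_mult ract_mult lact_ract lact_times times_ract
      ract_times lact_add_right ract_add_left algebra_simps)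

lemma norm_sd_mult: "norm (sd_mult lact ract p q) \<le> norm p * norm q"
proof -
  obtain a x b y where pq: "p = SD a x" "q = SD b y"
    by (metis semidirect.exhaust)
  have "norm (lact a y + ract x b + x * y) \<le> norm (lact a y) + norm (ract x b) + norm (x * y)"
    by (meson add_right_mono norm_triangle_ineq order_trans)
  also have "\<dots> \<le> norm a * norm y + norm x * norm b + norm x * norm y"
    by (intro add_mono norm_lact norm_ract norm_mult_ineq)
  finally show ?thesis
    using norm_mult_ineq[of a b]
    by (simp add: pq sd_mult_def norm_semidirect_def algebra_simps)
qed

end


section \<open>Derivations\<close>

text \<open>
  The multiplication of the algebra and the module actions are arguments, so that the notions
  apply to an algebra with class multiplication (\<open>(*)\<close>) and to the semidirect
  product (\<open>sd_mult lact ract\<close>) alike. An algebra with multiplication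
  \<open>m\<close> is a bimodule over itself with both actions \<open>m\<close>.
\<close>

definition derivation ::
    "('b \<Rightarrow> 'b \<Rightarrow> 'b) \<Rightarrow> ('b::complex_vector \<Rightarrow> 'x \<Rightarrow> 'x) \<Rightarrow>
     ('x \<Rightarrow> 'b \<Rightarrow> 'x) \<Rightarrow> ('b \<Rightarrow> 'x::complex_vector) \<Rightarrow> bool"
  where "derivation m l r \<delta> \<longleftrightarrow>
    Vector_Spaces.linear scaleC scaleC \<delta> \<and> (\<forall>b c. \<delta> (m b c) = l b (\<delta> c) + r (\<delta> b) c)"

definition inner_derivation ::
    "('b \<Rightarrow> 'x \<Rightarrow> 'x::minus) \<Rightarrow> ('x \<Rightarrow> 'b \<Rightarrow> 'x) \<Rightarrow> 'x \<Rightarrow> 'b \<Rightarrow> 'x"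
  where "inner_derivation l r x = (\<lambda>b. l b x - r x b)"

definition Z1 ::
    "('b \<Rightarrow> 'b \<Rightarrow> 'b) \<Rightarrow> ('b::complex_banach \<Rightarrow> 'x \<Rightarrow> 'x) \<Rightarrow>
     ('x \<Rightarrow> 'b \<Rightarrow> 'x) \<Rightarrow> ('b \<Rightarrow> 'x::complex_banach) set"
  where "Z1 m l r = {\<delta>. derivation m l r \<delta> \<and> continuous_on UNIV \<delta>}"

definition N1 ::
    "('b::complex_banach \<Rightarrow> 'x \<Rightarrow> 'x) \<Rightarrow> ('x \<Rightarrow> 'b \<Rightarrow> 'x) \<Rightarrow>
     ('b \<Rightarrow> 'x::complex_banach) set"
  where "N1 l r = range (inner_derivation l r)"

abbreviation Z1_self :: "('b \<Rightarrow> 'b \<Rightarrow> 'b) \<Rightarrow> ('b \<Rightarrow> 'b::complex_banach) set"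
  where "Z1_self m \<equiv> Z1 m m m"

text \<open>
  Unlike \<open>inner_derivation lact ract\<close>, which takes an element of the module, this map
  is induced by an element of the algebra and acts on the module.
\<close>

definition r_map ::
    "('a \<Rightarrow> 'u \<Rightarrow> 'u::minus) \<Rightarrow> ('u \<Rightarrow> 'a \<Rightarrow> 'u) \<Rightarrow> 'a \<Rightarrow> 'u \<Rightarrow> 'u"
  where "r_map lact ract a = (\<lambda>y. ract y a - lact a y)"


section \<open>Quotient spaces and linear isomorphism\<close>

record 'v lin_space =
  space_of :: "'v set"
  zero_of :: 'v
  add_of :: "'v \<Rightarrow> 'v \<Rightarrow> 'v"
  scale_of :: "complex \<Rightarrow> 'v \<Rightarrow> 'v"

text \<open>
  The space of cosets \<open>v + W\<close> with \<open>v\<close> in \<open>V\<close>. The scalar multiple of a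
  coset \<open>X\<close> is \<open>c X + W\<close> rather than just the image \<open>c X\<close>,
  which for \<open>c = 0\<close> would not be a coset.
\<close>

definition quotient_space :: "'v::complex_vector set \<Rightarrow> 'v set \<Rightarrow> 'v set lin_space"
  where "quotient_space V W =
    \<lparr> space_of = (\<lambda>v. v +o W) ` V,
      zero_of = W,
      add_of = (\<lambda>X Y. X + Y),
      scale_of = (\<lambda>c X. scaleC c ` X + W) \<rparr>"

lemma quotient_space_operations:
  assumes W: "complex_vector.subspace W"
  shows "add_of (quotient_space V W) (u +o W) (v +o W) = (u + v) +o W"
    and "scale_of (quotient_space V W) c (v +o W) = (c *\<^sub>C v) +o W"
    and "zero_of (quotient_space V W) = 0 +o W"
proof -
  have WW: "W + W = W"
  proof
    show "W + W \<subseteq> W"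
      using W by (auto simp: set_plus_def complex_vector.subspace_add)
    show "W \<subseteq> W + W"
      using complex_vector.subspace_0[OF W] by (force simp: set_plus_def)
  qed
  show "add_of (quotient_space V W) (u +o W) (v +o W) = (u + v) +o W"
    by (simp add: quotient_space_def set_plus_rearrange WW)
  have "scaleC c ` (v +o W) + W = (c *\<^sub>C v) +o (scaleC c ` W + W)"
    by (fastforce simp: elt_set_plus_def set_plus_def scaleC_add_right add.assoc)
  also have "scaleC c ` W + W = W"
  proof
    show "scaleC c ` W + W \<subseteq> W"
      using W by (auto simp: set_plus_def complex_vector.subspace_add complex_vector.subspace_scale)
    have "0 \<in> scaleC c ` W"
      using complex_vector.subspace_0[OF W] by force
    then show "W \<subseteq> scaleC c ` W + W"
      by (force simp: set_plus_def)
  qed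
  finally show "scale_of (quotient_space V W) c (v +o W) = (c *\<^sub>C v) +o W"
    by (simp add: quotient_space_def)
  show "zero_of (quotient_space V W) = 0 +o W"
    by (simp add: quotient_space_def elt_set_plus_def)
qed

definition trivial_space :: "'v lin_space \<Rightarrow> bool"
  where "trivial_space V \<longleftrightarrow> space_of V = {zero_of V}"

definition linearly_isomorphic :: "'v lin_space \<Rightarrow> 'w lin_space \<Rightarrow> bool"
  where "linearly_isomorphic V W \<longleftrightarrow>
    (\<exists>\<phi>. bij_betw \<phi> (space_of V) (space_of W) \<and>
      (\<forall>x\<in>space_of V. \<forall>y\<in>space_of V. \<phi> (add_of V x y) = add_of W (\<phi> x) (\<phi> y)) \<and>
      (\<forall>c. \<forall>x\<in>space_of V. \<phi> (scale_of V c x) = scale_of W c (\<phi> x)))"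

definition H1 ::
    "('b \<Rightarrow> 'b \<Rightarrow> 'b) \<Rightarrow> ('b::complex_banach \<Rightarrow> 'x \<Rightarrow> 'x) \<Rightarrow>
     ('x \<Rightarrow> 'b \<Rightarrow> 'x) \<Rightarrow> ('b \<Rightarrow> 'x::complex_banach) set lin_space"
  where "H1 m l r = quotient_space (Z1 m l r) (N1 l r)"

abbreviation H1_self :: "('b \<Rightarrow> 'b \<Rightarrow> 'b) \<Rightarrow> ('b \<Rightarrow> 'b::complex_banach) set lin_space"
  where "H1_self m \<equiv> H1 m m m"

definition E_space ::
    "('a::complex_banach_algebra \<Rightarrow> 'u::complex_banach_algebra \<Rightarrow> 'u) \<Rightarrow>
     ('u \<Rightarrow> 'a \<Rightarrow> 'u) \<Rightarrow> (('a \<Rightarrow> 'a) \<times> ('u \<Rightarrow> 'u)) set"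
  where "E_space lact ract =
    {(inner_derivation (*) (*) a, r_map lact ract a + inner_derivation (*) (*) x) | a x.
      inner_derivation lact ract x = 0}"

end

theory Submission
  imports Defs
begin

text \<open>
  Let \<open>\<Phi>\<close> send a pair \<open>(\<delta>, T)\<close> to the diagonal map \<open>(a, x) \<mapsto> (\<delta> a, T x)\<close> of the semidirect
  product. The isomorphism is the one that \<open>\<Phi>\<close> induces on quotients, and the proof consists of
  computing two preimages under \<open>\<Phi>\<close> and showing that its range meets every cohomology class.

  A linear map that preserves the ideal \<open>{0} \<times> U\<close> has the triangular form
  \<open>(a, x) \<mapsto> (\<delta> a, \<tau> a + T x)\<close>. Evaluating the Leibniz rule on the four kinds of products of
  elements \<open>(a, 0)\<close> and \<open>(0, x)\<close> shows that it is a derivation exactly when \<open>\<delta>\<close>, \<open>\<tau>\<close> and \<open>T\<close> are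
  derivations and \<open>T\<close> satisfies two twisted module homomorphism identities whose defect is given
  by the actions of \<open>\<delta> a\<close> and \<open>\<tau> a\<close> (\<open>triangular_mem_Z1_iff\<close>). For \<open>\<tau> = 0\<close>, and with all values
  of \<open>\<delta>\<close> in the annihilator, the defect vanishes; hence the preimage under \<open>\<Phi>\<close> of the continuous
  derivations is \<open>Z\<^sup>1(A) \<times> (Hom\<^sub>A(U) \<inter> Z\<^sup>1(U))\<close> (\<open>block_diagonal_mem_Z1_iff\<close>).

  The inner derivation given by \<open>(a, x)\<close> is triangular with \<open>\<delta> = id\<^sub>a\<close>, \<open>\<tau> = id\<^sub>A\<^sub>,\<^sub>x\<close> and
  \<open>T = r\<^sub>a + id\<^sub>U\<^sub>,\<^sub>x\<close>. So it is diagonal exactly when \<open>id\<^sub>A\<^sub>,\<^sub>x = 0\<close>, and the preimage under \<open>\<Phi>\<close> of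
  the inner derivations is the space \<open>E\<close> (\<open>block_diagonal_mem_N1_iff\<close>).

  Finally, if \<open>D\<close> is a continuous derivation with entries \<open>\<delta>\<close>, \<open>\<tau>\<close>, \<open>T\<close>, then \<open>\<tau>\<close> is a continuous
  derivation into the module, hence \<open>\<tau> = id\<^sub>A\<^sub>,\<^sub>x\<close> for some \<open>x\<close> because the first cohomology vanishes.
  Subtracting the inner derivation of \<open>(0, x)\<close> from \<open>D\<close> makes it diagonal
  (\<open>diagonal_modulo_inner\<close>). Thus every class in \<open>H\<^sup>1\<close> of the semidirect product has a diagonal
  representative, and the first isomorphism theorem (\<open>linearly_isomorphic_quotient_vimage\<close>)
  applies to \<open>\<Phi>\<close>.
\<close>

section \<open>Linear maps and quotients\<close>

lemma linear_scaleC_iff: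
  "Vector_Spaces.linear scaleC scaleC f \<longleftrightarrow>
    (\<forall>x y. f (x + y) = f x + f y) \<and> (\<forall>c x. f (c *\<^sub>C x) = c *\<^sub>C f x)"
  by (simp add: Vector_Spaces.linear_iff complex_vector.vector_space_axioms)

lemmas linear_scaleC_zero =
  module_hom.zero[OF Vector_Spaces.linear.axioms(3), of scaleC scaleC]
lemmas linear_scaleC_diff =
  module_hom.diff[OF Vector_Spaces.linear.axioms(3), of scaleC scaleC]
lemmas linear_scaleC_subspace_image =
  module_hom.subspace_image[OF Vector_Spaces.linear.axioms(3), of scaleC scaleC]
lemmas linear_scaleC_subspace_vimage =
  module_hom.subspace_vimage[OF Vector_Spaces.linear.axioms(3), of scaleC scaleC]

lemma continuous_on_linear_scaleC:
  fixes f :: "'b::complex_banach \<Rightarrow> 'c::complex_banach"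
  assumes "Vector_Spaces.linear scaleC scaleC f" and "\<And>x. norm (f x) \<le> norm x * K"
  shows "continuous_on UNIV f"
proof -
  have "bounded_linear f"
    using assms by (intro bounded_linear_intro[of f K]) (auto simp: linear_scaleC_iff scaleR_scaleC)
  then show ?thesis
    by (rule linear_continuous_on)
qed

lemma mem_elt_set_plus_iff: "x \<in> v +o W \<longleftrightarrow> x - v \<in> W" for v :: "'v::ab_group_add"
  by (metis set_minus_plus)

lemma elt_set_plus_eq_iff:
  fixes v w :: "'v::complex_vector"
  assumes "complex_vector.subspace W"
  shows "v +o W = w +o W \<longleftrightarrow> v - w \<in> W"
proof
  assume "v +o W = w +o W"
  moreover have "v \<in> v +o W"
    using assms by (simp add: mem_elt_set_plus_iff complex_vector.subspace_0)
  ultimately show "v - w \<in> W"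
    by (simp add: mem_elt_set_plus_iff)
next
  assume vw: "v - w \<in> W"
  have "x - v \<in> W \<longleftrightarrow> x - w \<in> W" for x
    using complex_vector.subspace_add[OF assms _ vw, of "x - v"]
      complex_vector.subspace_diff[OF assms _ vw, of "x - w"] by auto
  then show "v +o W = w +o W"
    by (auto simp: mem_elt_set_plus_iff)
qed

text \<open>
  This is the first isomorphism theorem for \<open>f\<close>, restricted to the preimage of \<open>Z\<close> and followed
  by the projection onto \<open>Z / N\<close>, whose kernel is the preimage of \<open>N\<close>. The inverse
  isomorphism needs no choice of representatives: it sends a coset of \<open>N\<close> to its preimage under
  \<open>f\<close>, which is a coset of the preimage of \<open>N\<close> since every class of \<open>Z\<close> modulo \<open>N\<close> meets the
  range of \<open>f\<close>.
\<close>

lemma linearly_isomorphic_quotient_vimage: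
  fixes f :: "'v::complex_vector \<Rightarrow> 'w::complex_vector"
  assumes f: "Vector_Spaces.linear scaleC scaleC f"
    and Z: "complex_vector.subspace Z" and N: "complex_vector.subspace N" and "N \<subseteq> Z"
    and surj: "\<And>z. z \<in> Z \<Longrightarrow> \<exists>v. z - f v \<in> N"
  shows "linearly_isomorphic (quotient_space Z N) (quotient_space (f -` Z) (f -` N))"
proof -
  note fN = linear_scaleC_subspace_vimage[OF f N]
  have coset: "f -` (z +o N) = v +o (f -` N)" if "z - f v \<in> N" for z v
  proof -
    have "z +o N = f v +o N"
      using that N by (simp add: elt_set_plus_eq_iff)
    then show ?thesis
      by (auto simp: mem_elt_set_plus_iff linear_scaleC_diff[OF f])
  qed
  have rep: "\<exists>v\<in>f -` Z. X = f v +o N" if X: "X \<in> space_of (quotient_space Z N)" for X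
  proof -
    from X obtain z where z: "z \<in> Z" "X = z +o N"
      by (auto simp: quotient_space_def)
    obtain v where v: "z - f v \<in> N"
      using surj[OF z(1)] by blast
    have "z - (z - f v) \<in> Z"
      using v \<open>N \<subseteq> Z\<close> z(1) by (blast intro: complex_vector.subspace_diff[OF Z])
    moreover have "X = f v +o N"
      using v z N by (simp add: elt_set_plus_eq_iff)
    ultimately show ?thesis
      by auto
  qed
  have coset_f: "f -` (f v +o N) = v +o (f -` N)" for v
    using complex_vector.subspace_0[OF N] by (intro coset) simp
  have f_add: "f u + f v = f (u + v)" and f_scale: "c *\<^sub>C f u = f (c *\<^sub>C u)" for c u v
    using f by (simp_all add: linear_scaleC_iff)
  let ?Q = "quotient_space Z N" and ?R = "quotient_space (f -` Z) (f -` N)"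
  have "bij_betw (vimage f) (space_of ?Q) (space_of ?R)"
  proof (rule bij_betw_imageI)
    show "inj_on (vimage f) (space_of ?Q)"
    proof (rule inj_onI)
      fix X Y assume X: "X \<in> space_of ?Q" and Y: "Y \<in> space_of ?Q" and eq: "f -` X = f -` Y"
      obtain u v where uv: "X = f u +o N" "Y = f v +o N"
        using rep[OF X] rep[OF Y] by blast
      have "u - v \<in> f -` N"
        using eq by (simp only: uv coset_f elt_set_plus_eq_iff[OF fN])
      then show "X = Y"
        by (simp add: uv elt_set_plus_eq_iff[OF N] linear_scaleC_diff[OF f])
    qed
    have "f -` X \<in> space_of ?R" if "X \<in> space_of ?Q" for X
      using rep[OF that] by (auto simp: coset_f) (simp add: quotient_space_def)
    moreover have "Y \<in> vimage f ` space_of ?Q" if Y: "Y \<in> space_of ?R" for Y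
    proof -
      obtain v where v: "f v \<in> Z" "Y = v +o (f -` N)"
        using Y by (auto simp: quotient_space_def)
      then have "Y = f -` (f v +o N)"
        by (simp only: coset_f)
      moreover have "f v +o N \<in> space_of ?Q"
        using v by (simp add: quotient_space_def)
      ultimately show ?thesis
        by blast
    qed
    ultimately show "vimage f ` space_of ?Q = space_of ?R"
      by blast
  qed
  moreover have "f -` add_of ?Q X Y = add_of ?R (f -` X) (f -` Y)"
    if X: "X \<in> space_of ?Q" and Y: "Y \<in> space_of ?Q" for X Y
  proof -
    obtain u v where uv: "X = f u +o N" "Y = f v +o N"
      using rep[OF X] rep[OF Y] by blast
    show ?thesis
      by (simp only: uv quotient_space_operations[OF N] coset_f quotient_space_operations[OF fN]
          f_add)
  qed
  moreover have "f -` scale_of ?Q c X = scale_of ?R c (f -` X)"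
    if X: "X \<in> space_of ?Q" for c X
  proof -
    obtain u where u: "X = f u +o N"
      using rep[OF X] by blast
    show ?thesis
      by (simp only: u quotient_space_operations[OF N] coset_f quotient_space_operations[OF fN]
          f_scale)
  qed
  ultimately show ?thesis
    unfolding linearly_isomorphic_def by blast
qed

section \<open>The topology of the semidirect product\<close>

lemma sd_scaleC_simps [simp]:
  "sd_fst (c *\<^sub>C p) = c *\<^sub>C sd_fst p" "sd_snd (c *\<^sub>C p) = c *\<^sub>C sd_snd p"
  by (simp_all add: scaleC_semidirect_def)

lemma continuous_on_sd_fst:
  "continuous_on UNIV (sd_fst :: ('a::complex_banach, 'u::complex_banach) semidirect \<Rightarrow> 'a)"
  by (rule continuous_on_linear_scaleC[where K = 1])
    (auto simp: linear_scaleC_iff norm_semidirect_def)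

lemma continuous_on_sd_snd:
  "continuous_on UNIV (sd_snd :: ('a::complex_banach, 'u::complex_banach) semidirect \<Rightarrow> 'u)"
  by (rule continuous_on_linear_scaleC[where K = 1])
    (auto simp: linear_scaleC_iff norm_semidirect_def)

lemma continuous_on_SD_left:
  "continuous_on UNIV (\<lambda>a::'a::complex_banach. SD a (0::'u::complex_banach))"
  by (rule continuous_on_linear_scaleC[where K = 1])
    (auto simp: linear_scaleC_iff norm_semidirect_def sd_eq_iff)

lemma continuous_on_SD_right:
  "continuous_on UNIV (\<lambda>x::'u::complex_banach. SD (0::'a::complex_banach) x)"
  by (rule continuous_on_linear_scaleC[where K = 1])
    (auto simp: linear_scaleC_iff norm_semidirect_def sd_eq_iff)

section \<open>Triangular maps\<close>

definition triangular ::
    "('a \<Rightarrow> 'a) \<Rightarrow> ('a \<Rightarrow> 'u) \<Rightarrow> ('u \<Rightarrow> 'u) \<Rightarrow> ('a, 'u::plus) semidirect \<Rightarrow> ('a, 'u) semidirect"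
  where "triangular \<delta> \<tau> T p = SD (\<delta> (sd_fst p)) (\<tau> (sd_fst p) + T (sd_snd p))"

lemma triangular_linear_iff:
  fixes \<tau> :: "'a::complex_vector \<Rightarrow> 'u::complex_vector"
  shows "Vector_Spaces.linear scaleC scaleC (triangular \<delta> \<tau> T) \<and> T 0 = 0 \<longleftrightarrow>
    Vector_Spaces.linear scaleC scaleC \<delta> \<and> Vector_Spaces.linear scaleC scaleC \<tau> \<and>
    Vector_Spaces.linear scaleC scaleC T" (is "?L \<longleftrightarrow> ?R")
proof
  assume R: ?R
  then have "T 0 = 0"
    by (simp add: linear_scaleC_zero)
  with R show ?L
    by (simp add: linear_scaleC_iff triangular_def sd_eq_iff scaleC_add_right algebra_simps)
next
  assume L: ?L
  then have add: "triangular \<delta> \<tau> T (p + q) = triangular \<delta> \<tau> T p + triangular \<delta> \<tau> T q"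
    and scale: "triangular \<delta> \<tau> T (c *\<^sub>C p) = c *\<^sub>C triangular \<delta> \<tau> T p" for p q c
    by (simp_all add: linear_scaleC_iff)
  have T0: "T 0 = 0" and \<tau>0: "\<tau> 0 = 0"
    using L linear_scaleC_zero[of "triangular \<delta> \<tau> T"] by (simp_all add: triangular_def sd_eq_iff)
  show ?R
    using add[of "SD a 0" "SD b 0" for a b] add[of "SD 0 x" "SD 0 y" for x y]
      scale[of c "SD a 0" for c a] scale[of c "SD 0 x" for c x] T0 \<tau>0
    by (simp add: linear_scaleC_iff triangular_def sd_eq_iff)
qed

lemma triangular_continuous_iff:
  fixes \<tau> :: "'a::complex_banach \<Rightarrow> 'u::complex_banach"
  assumes "T 0 = 0" and "\<tau> 0 = 0"
  shows "continuous_on UNIV (triangular \<delta> \<tau> T) \<longleftrightarrow>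
    continuous_on UNIV \<delta> \<and> continuous_on UNIV \<tau> \<and> continuous_on UNIV T" (is "?L \<longleftrightarrow> ?R")
proof
  assume ?L
  then have cont: "continuous_on UNIV (\<lambda>a. triangular \<delta> \<tau> T (SD a 0))"
      "continuous_on UNIV (\<lambda>x. triangular \<delta> \<tau> T (SD 0 x))"
    by (auto intro: continuous_on_compose2 continuous_on_SD_left continuous_on_SD_right)
  have "continuous_on UNIV (\<lambda>a. sd_fst (triangular \<delta> \<tau> T (SD a 0)))"
      "continuous_on UNIV (\<lambda>a. sd_snd (triangular \<delta> \<tau> T (SD a 0)))"
      "continuous_on UNIV (\<lambda>x. sd_snd (triangular \<delta> \<tau> T (SD 0 x)))"
    by (auto intro: continuous_on_compose2[OF continuous_on_sd_fst]
        continuous_on_compose2[OF continuous_on_sd_snd] cont)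
  then show ?R
    by (simp add: triangular_def assms)
next
  assume R: ?R
  have "continuous_on UNIV (\<lambda>p. SD (\<delta> (sd_fst p)) 0 + SD 0 (\<tau> (sd_fst p) + T (sd_snd p)))"
    using R
    by (intro continuous_on_add continuous_on_compose2[OF continuous_on_SD_left]
        continuous_on_compose2[OF continuous_on_SD_right] subset_UNIV
        continuous_on_compose2[OF _ continuous_on_sd_fst]
        continuous_on_compose2[OF _ continuous_on_sd_snd]) auto
  moreover have "triangular \<delta> \<tau> T =
      (\<lambda>p. SD (\<delta> (sd_fst p)) 0 + SD 0 (\<tau> (sd_fst p) + T (sd_snd p)))"
    by (simp add: fun_eq_iff triangular_def sd_eq_iff)
  ultimately show ?L
    by simp
qed

lemma linear_preserving_ideal_triangular:
  fixes D :: "('a::complex_vector, 'u::complex_vector) semidirect \<Rightarrow> ('a, 'u) semidirect"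
  assumes D: "Vector_Spaces.linear scaleC scaleC D"
    and ideal: "D ` {SD 0 x | x. True} \<subseteq> {SD 0 x | x. True}"
  obtains \<delta> \<tau> T where "D = triangular \<delta> \<tau> T" and "T 0 = 0"
proof
  have decomp: "D p = D (SD (sd_fst p) 0) + D (SD 0 (sd_snd p))" for p
  proof -
    have "p = SD (sd_fst p) 0 + SD 0 (sd_snd p)"
      by (simp add: sd_eq_iff)
    then show ?thesis
      using D by (metis linear_scaleC_iff)
  qed
  have fst: "sd_fst (D (SD 0 x)) = 0" for x
  proof -
    have "D (SD 0 x) \<in> {SD 0 x | x. True}"
      using ideal by blast
    then show ?thesis
      by auto
  qed
  show "D = triangular (\<lambda>a. sd_fst (D (SD a 0))) (\<lambda>a. sd_snd (D (SD a 0)))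
      (\<lambda>x. sd_snd (D (SD 0 x)))"
  proof
    fix p
    show "D p = triangular (\<lambda>a. sd_fst (D (SD a 0))) (\<lambda>a. sd_snd (D (SD a 0)))
        (\<lambda>x. sd_snd (D (SD 0 x))) p"
      by (subst decomp[of p]) (simp add: triangular_def sd_eq_iff fst)
  qed
  have "SD 0 0 = (0 :: ('a, 'u) semidirect)"
    by (simp add: sd_eq_iff)
  then show "sd_snd (D (SD 0 0)) = 0"
    using linear_scaleC_zero[OF D] by simp
qed

text \<open>
  The normalisations \<open>T 0 = 0\<close> and \<open>\<tau> 0 = 0\<close> hold for linear entries. They make the
  entries unique; otherwise a constant could be moved between \<open>\<tau>\<close> and \<open>T\<close>.
\<close>

lemma triangular_inject:
  fixes \<tau> \<tau>' :: "'a::zero \<Rightarrow> 'u::comm_monoid_add"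
  assumes "triangular \<delta> \<tau> T = triangular \<delta>' \<tau>' T'" and "T 0 = 0" "T' 0 = 0" "\<tau> 0 = 0" "\<tau>' 0 = 0"
  shows "\<delta> = \<delta>' \<and> \<tau> = \<tau>' \<and> T = T'"
  using fun_cong[OF assms(1), of "SD a 0" for a] fun_cong[OF assms(1), of "SD 0 x" for x] assms(2-)
  by (simp add: triangular_def fun_eq_iff)

section \<open>Derivations of the semidirect product\<close>

lemma subspace_Z1_self:
  fixes m :: "'b::complex_banach \<Rightarrow> 'b \<Rightarrow> 'b"
  assumes "\<And>x y z. m (x + y) z = m x z + m y z" "\<And>x y z. m x (y + z) = m x y + m x z"
    and "\<And>c x y. m (c *\<^sub>C x) y = c *\<^sub>C m x y" "\<And>c x y. m x (c *\<^sub>C y) = c *\<^sub>C m x y"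
  shows "complex_vector.subspace (Z1_self m)"
proof -
  have m0: "m 0 y = 0" "m y 0 = 0" for y
    using assms(1)[of 0 0 y] assms(2)[of y 0 0] by simp_all
  have scale: "continuous_on UNIV (\<lambda>x. c *\<^sub>C g x)" if "continuous_on UNIV g"
    for c and g :: "'b \<Rightarrow> 'b"
  proof -
    have "continuous_on UNIV (scaleC c :: 'b \<Rightarrow> 'b)"
      by (rule continuous_on_linear_scaleC[where K = "cmod c"])
        (auto simp: linear_scaleC_iff scaleC_add_right scaleC_scaleC norm_scaleC mult.commute)
    then show ?thesis
      by (rule continuous_on_compose2[OF _ that]) simp
  qed
  show ?thesis
    unfolding complex_vector.subspace_def Z1_def derivation_def linear_scaleC_iff
    by (auto simp: assms m0 plus_fun_def zero_fun_def scaleC_fun_def scaleC_add_right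
        scaleC_scaleC mult.commute algebra_simps continuous_on_add scale)
qed

lemma subspace_N1_self:
  fixes m :: "'b::complex_banach \<Rightarrow> 'b \<Rightarrow> 'b"
  assumes "\<And>x y z. m (x + y) z = m x z + m y z" "\<And>x y z. m x (y + z) = m x y + m x z"
    and "\<And>c x y. m (c *\<^sub>C x) y = c *\<^sub>C m x y" "\<And>c x y. m x (c *\<^sub>C y) = c *\<^sub>C m x y"
  shows "complex_vector.subspace (N1 m m)"
proof -
  have "Vector_Spaces.linear scaleC scaleC (inner_derivation m m)"
    by (simp add: linear_scaleC_iff inner_derivation_def fun_eq_iff assms scaleC_fun_def
        complex_vector.scale_right_diff_distrib)
  then show ?thesis
    unfolding N1_def by (rule linear_scaleC_subspace_image) (rule complex_vector.subspace_UNIV)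
qed

lemma N1_subset_Z1_self:
  fixes m :: "'b::complex_banach \<Rightarrow> 'b \<Rightarrow> 'b"
  assumes "\<And>x y z. m (x + y) z = m x z + m y z" "\<And>x y z. m x (y + z) = m x y + m x z"
    and "\<And>c x y. m (c *\<^sub>C x) y = c *\<^sub>C m x y" "\<And>c x y. m x (c *\<^sub>C y) = c *\<^sub>C m x y"
    and "\<And>x y z. m (m x y) z = m x (m y z)"
    and bound: "\<And>x y. norm (m x y) \<le> norm x * norm y"
  shows "N1 m m \<subseteq> Z1_self m"
proof -
  have minus: "m (x - y) z = m x z - m y z" "m x (y - z) = m x y - m x z" for x y z
    using assms(1)[of "x - y" y z] assms(2)[of x "y - z" z] by simp_all
  have "inner_derivation m m x \<in> Z1_self m" for x
  proof -
    have lin: "Vector_Spaces.linear scaleC scaleC (inner_derivation m m x)"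
      by (simp add: linear_scaleC_iff inner_derivation_def assms(1-4)
        complex_vector.scale_right_diff_distrib)
    have "norm (inner_derivation m m x y) \<le> norm y * (2 * norm x)" for y
      using norm_triangle_ineq4[of "m y x" "m x y"] bound[of y x] bound[of x y]
      by (simp add: inner_derivation_def algebra_simps)
    then have "continuous_on UNIV (inner_derivation m m x)"
      by (rule continuous_on_linear_scaleC[OF lin])
    with lin show ?thesis
      by (simp add: Z1_def derivation_def) (simp add: inner_derivation_def assms(5) minus)
  qed
  then show ?thesis
    by (auto simp: N1_def)
qed

definition block_diagonal ::
    "('a \<Rightarrow> 'a) \<times> ('u \<Rightarrow> 'u) \<Rightarrow> ('a, 'u::monoid_add) semidirect \<Rightarrow> ('a, 'u) semidirect"
  where "block_diagonal P = triangular (fst P) (\<lambda>_. 0) (snd P)"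

lemma linear_block_diagonal:
  "Vector_Spaces.linear scaleC scaleC
    (block_diagonal :: ('a::complex_vector \<Rightarrow> 'a) \<times> ('u::complex_vector \<Rightarrow> 'u) \<Rightarrow> _)"
  by (simp add: linear_scaleC_iff block_diagonal_def triangular_def fun_eq_iff sd_eq_iff
      scaleC_fun_def scaleC_prod_def)

context compatible_banach_bimodule
begin

lemma action_zero [simp]: "lact 0 x = 0" "lact a 0 = 0" "ract 0 a = 0" "ract x 0 = 0"
  using lact_add_left[of 0 0 x] lact_add_right[of a 0 0] ract_add_left[of 0 0 a]
    ract_add_right[of x 0 0] by simp_all

lemma sd_mult_bilinear:
  "sd_mult lact ract (p + q) r = sd_mult lact ract p r + sd_mult lact ract q r"
  "sd_mult lact ract p (q + r) = sd_mult lact ract p q + sd_mult lact ract p r"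
  "sd_mult lact ract (c *\<^sub>C p) q = c *\<^sub>C sd_mult lact ract p q"
  "sd_mult lact ract p (c *\<^sub>C q) = c *\<^sub>C sd_mult lact ract p q"
  by (simp_all add: sd_mult_def sd_eq_iff lact_add_left lact_add_right ract_add_left ract_add_right
      lact_scaleC_left lact_scaleC_right ract_scaleC_left ract_scaleC_right
      mult_scaleC_left mult_scaleC_right scaleC_add_right algebra_simps)

abbreviation "sd_Z1 \<equiv> Z1_self (sd_mult lact ract)"
abbreviation "sd_N1 \<equiv> N1 (sd_mult lact ract) (sd_mult lact ract)"

lemmas sd_subspace_Z1 = subspace_Z1_self[of "sd_mult lact ract", OF sd_mult_bilinear]
lemmas sd_subspace_N1 = subspace_N1_self[of "sd_mult lact ract", OF sd_mult_bilinear]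
lemmas sd_N1_subset_Z1 =
  N1_subset_Z1_self[of "sd_mult lact ract", OF sd_mult_bilinear sd_mult_assoc norm_sd_mult]

text \<open>
  By bilinearity the Leibniz rule only has to be tested on products of elements of the two
  summands. The products \<open>(a, 0) (b, 0)\<close> give the conditions on \<open>\<delta>\<close> and \<open>\<tau>\<close>, the products
  \<open>(0, x) (0, y)\<close> the one on \<open>T\<close>, and the mixed products the two identities for the actions.
\<close>

lemma triangular_mem_Z1_iff:
  assumes T0: "T 0 = 0"
  shows "triangular \<delta> \<tau> T \<in> sd_Z1 \<longleftrightarrow>
    \<delta> \<in> Z1_self (*) \<and> \<tau> \<in> Z1 (*) lact ract \<and> T \<in> Z1_self (*) \<and>
    (\<forall>a x. T (lact a x) = lact a (T x) + lact (\<delta> a) x + \<tau> a * x) \<and>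
    (\<forall>a x. T (ract x a) = ract (T x) a + ract x (\<delta> a) + x * \<tau> a)" (is "?L \<longleftrightarrow> ?R")
proof
  assume L: ?L
  then have lin: "Vector_Spaces.linear scaleC scaleC \<delta>" "Vector_Spaces.linear scaleC scaleC \<tau>"
      "Vector_Spaces.linear scaleC scaleC T"
    using triangular_linear_iff[of \<delta> \<tau> T] T0 by (auto simp: Z1_def derivation_def)
  have zero: "\<delta> 0 = 0" "\<tau> 0 = 0"
    using lin by (simp_all add: linear_scaleC_zero)
  have leibniz: "triangular \<delta> \<tau> T (sd_mult lact ract p q) =
      sd_mult lact ract p (triangular \<delta> \<tau> T q) + sd_mult lact ract (triangular \<delta> \<tau> T p) q" for p q
    using L by (simp add: Z1_def derivation_def)
  have "\<delta> (a * b) = a * \<delta> b + \<delta> a * b" "\<tau> (a * b) = lact a (\<tau> b) + ract (\<tau> a) b" for a b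
    using leibniz[of "SD a 0" "SD b 0"] by (simp_all add: triangular_def sd_mult_def sd_eq_iff T0)
  moreover have "T (x * y) = x * T y + T x * y" for x y
    using leibniz[of "SD 0 x" "SD 0 y"]
    by (simp add: triangular_def sd_mult_def sd_eq_iff zero)
  moreover have "T (lact a x) = lact a (T x) + lact (\<delta> a) x + \<tau> a * x" for a x
    using leibniz[of "SD a 0" "SD 0 x"]
    by (simp add: triangular_def sd_mult_def sd_eq_iff zero T0 algebra_simps)
  moreover have "T (ract x a) = ract (T x) a + ract x (\<delta> a) + x * \<tau> a" for a x
    using leibniz[of "SD 0 x" "SD a 0"]
    by (simp add: triangular_def sd_mult_def sd_eq_iff zero T0 algebra_simps)
  moreover have "continuous_on UNIV \<delta> \<and> continuous_on UNIV \<tau> \<and> continuous_on UNIV T"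
    using L triangular_continuous_iff[of T \<tau> \<delta>] T0 zero by (simp add: Z1_def)
  ultimately show ?R
    using lin by (simp add: Z1_def derivation_def)
next
  assume R: ?R
  then have lin: "Vector_Spaces.linear scaleC scaleC \<delta>" "Vector_Spaces.linear scaleC scaleC \<tau>"
      "Vector_Spaces.linear scaleC scaleC T"
    by (simp_all add: Z1_def derivation_def)
  have "continuous_on UNIV (triangular \<delta> \<tau> T)"
    using R lin triangular_continuous_iff[of T \<tau> \<delta>] by (simp add: Z1_def linear_scaleC_zero)
  moreover have "Vector_Spaces.linear scaleC scaleC (triangular \<delta> \<tau> T)"
    using lin triangular_linear_iff[of \<delta> \<tau> T] by simp
  moreover have "triangular \<delta> \<tau> T (sd_mult lact ract p q) =
      sd_mult lact ract p (triangular \<delta> \<tau> T q) + sd_mult lact ract (triangular \<delta> \<tau> T p) q" for p q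
    using R lin
    by (simp add: Z1_def derivation_def triangular_def sd_mult_def sd_eq_iff linear_scaleC_iff
        lact_add_right ract_add_left algebra_simps)
  ultimately show ?L
    by (simp add: Z1_def derivation_def)
qed

lemma block_diagonal_zero:
  assumes "Vector_Spaces.linear scaleC scaleC (block_diagonal (\<delta>, T))"
  shows "T 0 = 0"
  using linear_scaleC_zero[OF assms] by (simp add: block_diagonal_def triangular_def sd_eq_iff)

text \<open>
  The hypothesis on the annihilator decouples \<open>\<delta>\<close> from \<open>T\<close>: the two mixed Leibniz identities
  for \<open>\<tau> = 0\<close> differ from the module homomorphism property of \<open>T\<close> by the terms \<open>\<delta>(a) x\<close> and \<open>x \<delta>(a)\<close>, which are zero.
\<close>

lemma block_diagonal_mem_Z1_iff:
  assumes ann: "\<And>\<delta>. \<delta> \<in> Z1_self (*) \<Longrightarrow> range \<delta> \<subseteq> bimodule_annihilator lact ract"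
  shows "block_diagonal P \<in> sd_Z1 \<longleftrightarrow>
    P \<in> Z1_self (*) \<times> (Hom_bimodule lact ract \<inter> Z1_self (*))"
proof -
  obtain \<delta> T where P: "P = (\<delta>, T)"
    by (rule prod.exhaust)
  have "T 0 = 0" if "block_diagonal P \<in> sd_Z1 \<or> T \<in> Z1_self (*)"
    using that block_diagonal_zero[of \<delta> T] linear_scaleC_zero[of T]
    by (auto simp: P Z1_def derivation_def)
  moreover have "(\<lambda>_. 0) \<in> Z1 (*) lact ract"
    by (simp add: Z1_def derivation_def linear_scaleC_iff)
  moreover have "lact (\<delta> a) x = 0" "ract x (\<delta> a) = 0" if "\<delta> \<in> Z1_self (*)" for a x
    using ann[OF that] by (auto simp: bimodule_annihilator_def)
  moreover have "T \<in> Hom_bimodule lact ract \<longleftrightarrow>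
      (\<forall>a x. T (lact a x) = lact a (T x)) \<and> (\<forall>a x. T (ract x a) = ract (T x) a)"
    if "T \<in> Z1_self (*)"
    using that by (auto simp: Hom_bimodule_def Z1_def derivation_def)
  ultimately show ?thesis
    using triangular_mem_Z1_iff[of T \<delta> "\<lambda>_. 0"] by (auto simp: P block_diagonal_def)
qed

lemma inner_derivation_sd:
  "inner_derivation (sd_mult lact ract) (sd_mult lact ract) (SD a x) =
    triangular (inner_derivation (*) (*) a) (inner_derivation lact ract x)
      (r_map lact ract a + inner_derivation (*) (*) x)"
  by (simp add: fun_eq_iff inner_derivation_def triangular_def r_map_def sd_mult_def sd_eq_iff)

text \<open>
  Comparing the entries of an inner derivation with those of a diagonal map gives the defining
  formula of \<open>E\<close>; the condition \<open>id\<^sub>A\<^sub>,\<^sub>x = 0\<close> in it says that the off-diagonal entry is zero.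
\<close>

lemma block_diagonal_mem_N1_iff:
  "block_diagonal P \<in> sd_N1 \<longleftrightarrow> P \<in> E_space lact ract"
proof (cases P, hypsubst, rule iffI)
  fix \<delta> T
  assume inner: "block_diagonal (\<delta>, T) \<in> sd_N1"
  then have T0: "T 0 = 0"
    using sd_N1_subset_Z1 by (auto intro!: block_diagonal_zero simp: Z1_def derivation_def)
  from inner obtain a x where "block_diagonal (\<delta>, T) =
      inner_derivation (sd_mult lact ract) (sd_mult lact ract) (SD a x)"
    unfolding N1_def by (metis imageE semidirect.exhaust)
  then have "triangular \<delta> (\<lambda>_. 0) T = triangular (inner_derivation (*) (*) a)
      (inner_derivation lact ract x) (r_map lact ract a + inner_derivation (*) (*) x)"
    by (simp add: block_diagonal_def inner_derivation_sd)
  from triangular_inject[OF this T0] have "\<delta> = inner_derivation (*) (*) a"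
      "inner_derivation lact ract x = 0" "T = r_map lact ract a + inner_derivation (*) (*) x"
    by (auto simp: inner_derivation_def r_map_def zero_fun_def)
  then show "(\<delta>, T) \<in> E_space lact ract"
    by (auto simp: E_space_def)
next
  fix \<delta> T
  assume "(\<delta>, T) \<in> E_space lact ract"
  then obtain a x where "\<delta> = inner_derivation (*) (*) a"
      "inner_derivation lact ract x = 0" "T = r_map lact ract a + inner_derivation (*) (*) x"
    by (auto simp: E_space_def)
  then have "block_diagonal (\<delta>, T) =
      inner_derivation (sd_mult lact ract) (sd_mult lact ract) (SD a x)"
    by (simp add: block_diagonal_def inner_derivation_sd zero_fun_def)
  then show "block_diagonal (\<delta>, T) \<in> sd_N1"
    by (simp add: N1_def)
qed

text \<open>
  The off-diagonal entry \<open>\<tau>\<close> is inner, say \<open>\<tau> = id\<^sub>A\<^sub>,\<^sub>x\<close>. The inner derivation of \<open>(0, x)\<close> has the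
  same off-diagonal entry and its \<open>A\<close>-component is zero, so subtracting it removes \<open>\<tau>\<close> and
  changes \<open>T\<close> to \<open>T - id\<^sub>U\<^sub>,\<^sub>x\<close>.
\<close>

lemma diagonal_modulo_inner:
  assumes D: "D \<in> sd_Z1" and ideal: "D ` {SD 0 x | x. True} \<subseteq> {SD 0 x | x. True}"
    and H1: "Z1 (*) lact ract \<subseteq> N1 lact ract"
  shows "\<exists>P. D - block_diagonal P \<in> sd_N1"
proof -
  have "Vector_Spaces.linear scaleC scaleC D"
    using D by (simp add: Z1_def derivation_def)
  then obtain \<delta> \<tau> T where tri: "D = triangular \<delta> \<tau> T" "T 0 = 0"
    using ideal by (rule linear_preserving_ideal_triangular)
  then have "\<tau> \<in> Z1 (*) lact ract"
    using D triangular_mem_Z1_iff[of T \<delta> \<tau>] by simp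
  then obtain x where x: "\<tau> = inner_derivation lact ract x"
    using H1 by (auto simp: N1_def)
  have "D - block_diagonal (\<delta>, T - inner_derivation (*) (*) x) =
      triangular (inner_derivation (*) (*) 0) \<tau> (r_map lact ract 0 + inner_derivation (*) (*) x)"
    by (simp add: tri block_diagonal_def triangular_def fun_eq_iff sd_eq_iff inner_derivation_def
        r_map_def)
  also have "\<dots> = inner_derivation (sd_mult lact ract) (sd_mult lact ract) (SD 0 x)"
    by (simp only: x inner_derivation_sd)
  finally show ?thesis
    by (metis N1_def rangeI)
qed

end

lemma trivial_H1_imp:
  assumes "trivial_space (H1 m l r)" and "0 \<in> N1 l r"
  shows "Z1 m l r \<subseteq> N1 l r"
proof
  fix \<delta> assume "\<delta> \<in> Z1 m l r"
  then have "\<delta> +o N1 l r = N1 l r"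
    using assms(1) by (auto simp: trivial_space_def H1_def quotient_space_def)
  then show "\<delta> \<in> N1 l r"
    using set_plus_intro2[OF assms(2), of \<delta>] by simp
qed

theorem theorem4p1:
  fixes lact :: "'a::complex_banach_algebra \<Rightarrow> 'u::complex_banach_algebra \<Rightarrow> 'u"
    and ract :: "'u \<Rightarrow> 'a \<Rightarrow> 'u"
  assumes "compatible_banach_bimodule lact ract"
    and "\<And>D :: ('a, 'u) semidirect \<Rightarrow> ('a, 'u) semidirect.
      derivation (sd_mult lact ract) (sd_mult lact ract) (sd_mult lact ract) D \<Longrightarrow>
      D ` {SD 0 x | x. True} \<subseteq> {SD 0 x | x. True}"
    and "\<And>\<delta> :: 'a \<Rightarrow> 'a. \<delta> \<in> Z1_self (*) \<Longrightarrow> range \<delta> \<subseteq> bimodule_annihilator lact ract"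
    and "trivial_space (H1 (*) lact ract)"
  shows "E_space lact ract \<subseteq> Z1_self (*) \<times> (Hom_bimodule lact ract \<inter> Z1_self (*)) \<and>
    complex_vector.subspace (E_space lact ract) \<and>
    linearly_isomorphic
      (H1_self (sd_mult lact ract))
      (quotient_space (Z1_self (*) \<times> (Hom_bimodule lact ract \<inter> Z1_self (*))) (E_space lact ract))"
proof -
  interpret compatible_banach_bimodule lact ract
    by (rule assms(1))
  have "inner_derivation lact ract 0 = 0"
    by (simp add: inner_derivation_def fun_eq_iff)
  then have "0 \<in> N1 lact ract"
    by (metis N1_def rangeI)
  with assms(4) have H1: "Z1 (*) lact ract \<subseteq> N1 lact ract"
    by (rule trivial_H1_imp)
  have V: "block_diagonal -` sd_Z1 = Z1_self (*) \<times> (Hom_bimodule lact ract \<inter> Z1_self (*))"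
    using block_diagonal_mem_Z1_iff[OF assms(3)] by (auto simp del: mem_Times_iff)
  have E: "block_diagonal -` sd_N1 = E_space lact ract"
    using block_diagonal_mem_N1_iff by auto
  have "E_space lact ract \<subseteq> Z1_self (*) \<times> (Hom_bimodule lact ract \<inter> Z1_self (*))"
    using sd_N1_subset_Z1 unfolding E[symmetric] V[symmetric] by (rule vimage_mono)
  moreover have "complex_vector.subspace (E_space lact ract)"
    unfolding E[symmetric] by (rule linear_scaleC_subspace_vimage[OF linear_block_diagonal sd_subspace_N1])
  moreover have "linearly_isomorphic (quotient_space sd_Z1 sd_N1)
      (quotient_space (block_diagonal -` sd_Z1) (block_diagonal -` sd_N1))"
  proof (rule linearly_isomorphic_quotient_vimage[OF linear_block_diagonal sd_subspace_Z1
        sd_subspace_N1 sd_N1_subset_Z1])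
    fix D assume D: "D \<in> sd_Z1"
    then have "D ` {SD 0 x | x. True} \<subseteq> {SD 0 x | x. True}"
      by (intro assms(2)) (simp add: Z1_def)
    with D show "\<exists>P. D - block_diagonal P \<in> sd_N1"
      using H1 by (rule diagonal_modulo_inner)
  qed
  ultimately show ?thesis
    unfolding V E H1_def by (intro conjI)
qed

end
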